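(* Let $X_1,X_2,\ldots$ be i.i.d. with distribution $F$ having density $f$, let $G$ be another distribution with density $g$ (both with respect to the same reference measure $\mu$), and let $\{W_n\}$ be the CUSUM process generated by the log-likelihood ratios $Y_i=\log\frac{g(X_i)}{f(X_i)}$. Then for every $n\ge1$ and every $h$, $$\mathbb{E}_F e^{W_n}\le n+1,\qquad \mathbb{P}_F\Bigl\{\max_{0\le t\le n}W_t\ge h\Bigr\}\le e^{-h}(n+1).$$ Consequently, for any $\alpha\in(0,1)$, the threshold $h(\alpha)=\log\frac{n+1}{\alpha}$, which does not depend on $F$ and $G$, guarantees $$\mathbb{P}_F\Bigl\{\max_{0\le t\le n}W_t\ge h(\alpha)\Bigr\}\le\alpha .$$
   Context: The CUSUM process based on $Y_1,Y_2,\ldots$ is defined by $W_0=0$ and $W_{n+1}=\max\{W_n+Y_{n+1},0\}$. $\mathbb{P}_F$ and $\mathbb{E}_F$ denote probability and expectation when the $X_i$ are i.i.d. from $F$. The log-likelihood ratios are taken to be well defined real random variables under $F$ with $\mathbb{E}_F e^{Y_i}=\int g\,d\mu=1$. *)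

theory Defs
  imports "HOL-Probability.Probability"
begin

definition prob_density :: "'b measure \<Rightarrow> ('b \<Rightarrow> real) \<Rightarrow> 'b measure \<Rightarrow> bool" where
  "prob_density \<mu> f F \<longleftrightarrow>
     f \<in> borel_measurable \<mu> \<and> (\<forall>x\<in>space \<mu>. 0 \<le> f x) \<and>
     F = density \<mu> (\<lambda>x. ennreal (f x)) \<and> prob_space F"

text \<open>The observations are \<open>X 1, X 2, \<dots>\<close>; \<open>X 0\<close> is unconstrained and never used.
  Measurability of each \<open>X i\<close> is part of \<^const>\<open>prob_space.indep_vars\<close>.\<close>

definition iid_from :: "'a measure \<Rightarrow> 'b measure \<Rightarrow> (nat \<Rightarrow> 'a \<Rightarrow> 'b) \<Rightarrow> bool" where
  "iid_from M F X \<longleftrightarrow>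
     prob_space.indep_vars M (\<lambda>_. F) X {1..} \<and> (\<forall>i\<ge>1. distr M F (X i) = F)"

definition llr :: "('b \<Rightarrow> real) \<Rightarrow> ('b \<Rightarrow> real) \<Rightarrow> 'b \<Rightarrow> real" where
  "llr f g x = ln (g x / f x)"

text \<open>HOL's \<^const>\<open>ln\<close> and division are total, so that the log-likelihood ratio is a genuine
  real number must be stated: both densities are positive almost surely under \<open>F\<close>.\<close>

definition llr_well_defined :: "'b measure \<Rightarrow> ('b \<Rightarrow> real) \<Rightarrow> ('b \<Rightarrow> real) \<Rightarrow> bool" where
  "llr_well_defined F f g \<longleftrightarrow> (AE x in F. 0 < f x \<and> 0 < g x)"

fun cusum :: "(nat \<Rightarrow> real) \<Rightarrow> nat \<Rightarrow> real" where
  "cusum y 0 = 0"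
| "cusum y (Suc n) = max (cusum y n + y (Suc n)) 0"

definition llr_cusum ::
  "('b \<Rightarrow> real) \<Rightarrow> ('b \<Rightarrow> real) \<Rightarrow> (nat \<Rightarrow> 'a \<Rightarrow> 'b) \<Rightarrow> nat \<Rightarrow> 'a \<Rightarrow> real" where
  "llr_cusum f g X n \<omega> = cusum (\<lambda>i. llr f g (X i \<omega>)) n"

definition threshold :: "nat \<Rightarrow> real \<Rightarrow> real" where
  "threshold n \<alpha> = ln ((real n + 1) / \<alpha>)"

end

theory Submission
  imports Defs
begin

text \<open>Exponentiating, \<open>V = exp W\<close> obeys \<open>V (n + 1) = max (V n * L (n + 1)) 1 \<le> V n * L (n + 1) + 1\<close>,
  where \<open>L (n + 1) = exp (Y (n + 1))\<close> has mean \<open>1\<close> and is independent of \<open>V n\<close>, so each step adds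
  at most \<open>1\<close> to the mean. Freezing \<open>V\<close> once it has entered a set \<open>A\<close> preserves this
  bound: \<open>A = {}\<close> gives the bound on the exponential moment, and \<open>A = {exp h..}\<close> together with
  Markov's inequality for the frozen process gives the maximal inequality.\<close>

fun frozen_exp_cusum :: "real set \<Rightarrow> (nat \<Rightarrow> real) \<Rightarrow> nat \<Rightarrow> real" where
  "frozen_exp_cusum A l 0 = 1"
| "frozen_exp_cusum A l (Suc n) =
     (if frozen_exp_cusum A l n \<in> A then frozen_exp_cusum A l n
      else max (frozen_exp_cusum A l n * l (Suc n)) 1)"

lemma frozen_exp_cusum_ge_1: "1 \<le> frozen_exp_cusum A l n"
  by (induction n) auto

text \<open>The recursion reads only \<open>l 1\<close>, ..., \<open>l n\<close>, so a path may be
  replaced by its restriction to \<open>{1..n}\<close>, the form in which independence of blocks is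
  available.\<close>

lemma frozen_exp_cusum_cong:
  assumes "\<And>i. 1 \<le> i \<Longrightarrow> i \<le> n \<Longrightarrow> l i = l' i"
  shows "frozen_exp_cusum A l n = frozen_exp_cusum A l' n"
  using assms by (induction n) auto

lemma frozen_exp_cusum_empty: "frozen_exp_cusum {} (\<lambda>i. exp (y i)) n = exp (cusum y n)"
  by (induction n) (auto simp: max_def exp_add[symmetric])

text \<open>While the value stays below \<open>c\<close>, both sides follow the same recursion,
  because \<open>exp\<close> turns sums into products and is monotone with \<open>exp 0 = 1\<close>.
  Once the value reaches \<open>c\<close> it never moves again.\<close>

lemma frozen_exp_cusum_eq_or_ge:
  "frozen_exp_cusum {c..} (\<lambda>i. exp (y i)) n \<ge> c \<or>
   frozen_exp_cusum {c..} (\<lambda>i. exp (y i)) n = exp (cusum y n)"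
  by (induction n) (auto simp: max_def exp_add[symmetric])

text \<open>At time \<open>t\<close> both cases of the dichotomy give a value of at least
  \<open>c\<close>, and freezing preserves it up to \<open>n\<close>. A crossing at any earlier time
  is thus visible at time \<open>n\<close> alone, so Markov's inequality at a single time controls
  the running maximum.\<close>

lemma frozen_exp_cusum_ge_of_cusum_ge:
  assumes "t \<le> n" and "exp (cusum y t) \<ge> c"
  shows "frozen_exp_cusum {c..} (\<lambda>i. exp (y i)) n \<ge> c"
  using assms(1)
proof (induction n rule: dec_induct)
  case base
  then show ?case using frozen_exp_cusum_eq_or_ge[of c y t] assms(2) by auto
qed auto

text \<open>The separate bound \<open>m\<close> keeps the product space fixed while the induction
  runs over \<open>n\<close>.\<close>

lemma frozen_exp_cusum_measurable:
  assumes [measurable]: "A \<in> sets borel" and "n \<le> m"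
  shows "(\<lambda>l. frozen_exp_cusum A l n) \<in> borel_measurable (Pi\<^sub>M {1..m} (\<lambda>_. borel))"
  using assms(2)
proof (induction n)
  case (Suc n)
  then have [measurable]: "(\<lambda>l. frozen_exp_cusum A l n) \<in> borel_measurable (Pi\<^sub>M {1..m} (\<lambda>_. borel))"
    by simp
  have [measurable]: "(\<lambda>l. l (Suc n)) \<in> borel_measurable (Pi\<^sub>M {1..m} (\<lambda>_. borel :: real measure))"
    using Suc.prems by (intro measurable_component_singleton) auto
  show ?case unfolding frozen_exp_cusum.simps by measurable
qed simp

context prob_space
begin

lemma frozen_exp_cusum_moment:
  assumes indep: "indep_vars (\<lambda>_. borel) L {1..}"
    and L_pos: "\<And>i \<omega>. 0 \<le> L i \<omega>"
    and L_int: "\<And>i. 1 \<le> i \<Longrightarrow> integrable M (L i)"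
    and L_mean: "\<And>i. 1 \<le> i \<Longrightarrow> expectation (L i) = 1"
    and A [measurable]: "A \<in> sets borel"
  shows "integrable M (\<lambda>\<omega>. frozen_exp_cusum A (\<lambda>i. L i \<omega>) n) \<and>
    expectation (\<lambda>\<omega>. frozen_exp_cusum A (\<lambda>i. L i \<omega>) n) \<le> real n + 1"
proof (induction n)
  case 0
  show ?case by (simp add: prob_space)
next
  case (Suc n)
  define V where "V \<omega> = frozen_exp_cusum A (\<lambda>i. L i \<omega>) n" for \<omega>
  define U where "U \<omega> = indicator (- A) (V \<omega>) * V \<omega>" for \<omega>
  define D where "D \<omega> = indicator A (V \<omega>) * V \<omega>" for \<omega>
  have V_int: "integrable M V" and V_mean: "expectation V \<le> real n + 1"
    using Suc.IH by (auto simp: V_def[abs_def])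
  have [measurable]: "V \<in> borel_measurable M"
    using V_int by simp
  have L_meas [measurable]: "L (Suc n) \<in> borel_measurable M"
    using L_int by simp
  have V_ge: "1 \<le> V \<omega>" for \<omega>
    by (simp add: V_def frozen_exp_cusum_ge_1)
  have [measurable]: "U \<in> borel_measurable M" "D \<in> borel_measurable M"
    unfolding U_def[abs_def] D_def[abs_def] by measurable
  have U_int: "integrable M U"
    by (rule Bochner_Integration.integrable_bound[OF V_int])
      (auto simp: U_def indicator_def)
  have D_int: "integrable M D"
    by (rule Bochner_Integration.integrable_bound[OF V_int])
      (auto simp: D_def indicator_def)
  \<comment> \<open>\<open>U\<close> is written as a function of the first \<open>n\<close> factors
    only, which makes it independent of \<open>L (Suc n)\<close>.\<close>
  define \<phi> where "\<phi> l = indicator (- A) (frozen_exp_cusum A l n) * frozen_exp_cusum A l n" for l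
  have [measurable]: "(\<lambda>l. frozen_exp_cusum A l n) \<in> borel_measurable (Pi\<^sub>M {1..n} (\<lambda>_. borel))"
    by (rule frozen_exp_cusum_measurable) auto
  have \<phi>_meas: "\<phi> \<in> borel_measurable (Pi\<^sub>M {1..n} (\<lambda>_. borel))"
    unfolding \<phi>_def by measurable
  have "indep_var (Pi\<^sub>M {1..n} (\<lambda>_. borel)) (\<lambda>\<omega>. \<lambda>i\<in>{1..n}. L i \<omega>)
      (Pi\<^sub>M {Suc n} (\<lambda>_. borel)) (\<lambda>\<omega>. \<lambda>i\<in>{Suc n}. L i \<omega>)"
    using indep by (rule indep_var_restrict) auto
  from indep_var_compose[OF this \<phi>_meas measurable_component_singleton[of "Suc n"]]
  have "indep_var borel (\<phi> \<circ> (\<lambda>\<omega>. \<lambda>i\<in>{1..n}. L i \<omega>))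
      borel ((\<lambda>l. l (Suc n)) \<circ> (\<lambda>\<omega>. \<lambda>i\<in>{Suc n}. L i \<omega>))"
    by simp
  moreover have "\<phi> \<circ> (\<lambda>\<omega>. \<lambda>i\<in>{1..n}. L i \<omega>) = U"
  proof
    fix \<omega>
    have "frozen_exp_cusum A (\<lambda>i\<in>{1..n}. L i \<omega>) n = V \<omega>"
      unfolding V_def by (rule frozen_exp_cusum_cong) auto
    then show "(\<phi> \<circ> (\<lambda>\<omega>. \<lambda>i\<in>{1..n}. L i \<omega>)) \<omega> = U \<omega>"
      by (simp add: \<phi>_def U_def)
  qed
  moreover have "(\<lambda>l. l (Suc n)) \<circ> (\<lambda>\<omega>. \<lambda>i\<in>{Suc n}. L i \<omega>) = L (Suc n)"
    by auto
  ultimately have UL: "indep_var borel U borel (L (Suc n))"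
    by simp
  have UL_int: "integrable M (\<lambda>\<omega>. U \<omega> * L (Suc n) \<omega>)"
    using indep_var_integrable[OF UL U_int L_int] by simp
  have UL_mean: "expectation (\<lambda>\<omega>. U \<omega> * L (Suc n) \<omega>) = expectation U"
    using indep_var_lebesgue_integral[OF UL U_int L_int] L_mean by simp
  let ?V' = "\<lambda>\<omega>. frozen_exp_cusum A (\<lambda>i. L i \<omega>) (Suc n)"
  have V'_eq: "?V' \<omega> = (if V \<omega> \<in> A then V \<omega> else max (V \<omega> * L (Suc n) \<omega>) 1)" for \<omega>
    by (simp add: V_def)
  \<comment> \<open>If \<open>V \<omega>\<close> lies in \<open>A\<close>, then \<open>U\<close>
    vanishes and \<open>D\<close> is the new value. Otherwise \<open>D\<close> vanishes, and the
    maximum of a nonnegative product and 1 is at most their sum.\<close>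
  have V'_le: "?V' \<omega> \<le> D \<omega> + U \<omega> * L (Suc n) \<omega> + 1" for \<omega>
    using V_ge[of \<omega>] L_pos[of "Suc n" \<omega>] unfolding V'_eq
    by (auto simp: D_def U_def)
  have bound_int: "integrable M (\<lambda>\<omega>. D \<omega> + U \<omega> * L (Suc n) \<omega> + 1)"
    using D_int UL_int by simp
  have V'_int: "integrable M ?V'"
  proof (rule Bochner_Integration.integrable_bound[OF bound_int])
    show "?V' \<in> borel_measurable M"
      unfolding V'_eq by measurable
    show "AE \<omega> in M. norm (?V' \<omega>) \<le> norm (D \<omega> + U \<omega> * L (Suc n) \<omega> + 1)"
    proof (rule AE_I2)
      fix \<omega>
      show "norm (?V' \<omega>) \<le> norm (D \<omega> + U \<omega> * L (Suc n) \<omega> + 1)"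
        using V'_le[of \<omega>] frozen_exp_cusum_ge_1[of A "\<lambda>i. L i \<omega>" "Suc n"]
        unfolding real_norm_def by linarith
    qed
  qed
  have "expectation ?V' \<le> expectation (\<lambda>\<omega>. D \<omega> + U \<omega> * L (Suc n) \<omega> + 1)"
    by (rule integral_mono[OF V'_int bound_int V'_le])
  \<comment> \<open>The mean-one factor leaves the active mean unchanged, so the two parts recombine
    to the mean of \<open>V\<close> and the step costs exactly the added 1.\<close>
  also have "\<dots> = expectation D + expectation U + 1"
    using D_int UL_int by (simp add: UL_mean prob_space)
  also have "expectation D + expectation U = expectation V"
    unfolding Bochner_Integration.integral_add[OF D_int U_int, symmetric]
    by (rule Bochner_Integration.integral_cong) (auto simp: D_def U_def indicator_def)
  finally show ?case using V'_int V_mean by simp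
qed

lemma cusum_exp_moment:
  assumes indep: "indep_vars (\<lambda>_. borel) (\<lambda>i \<omega>. exp (Y i \<omega>) :: real) {1..}"
    and mean: "\<And>i. 1 \<le> i \<Longrightarrow> expectation (\<lambda>\<omega>. exp (Y i \<omega>)) = 1"
  shows "integrable M (\<lambda>\<omega>. exp (cusum (\<lambda>i. Y i \<omega>) n))"
    and "expectation (\<lambda>\<omega>. exp (cusum (\<lambda>i. Y i \<omega>) n)) \<le> real n + 1"
    and "prob {\<omega> \<in> space M. (MAX t\<in>{0..n}. cusum (\<lambda>i. Y i \<omega>) t) \<ge> h}
      \<le> exp (- h) * (real n + 1)"
proof -
  \<comment> \<open>the Bochner integral of a non-integrable function is \<open>0\<close>\<close>
  have int: "integrable M (\<lambda>\<omega>. exp (Y i \<omega>))" if "1 \<le> i" for i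
    using mean[OF that] not_integrable_integral_eq by fastforce
  note moment = frozen_exp_cusum_moment[OF indep _ int mean]
  show "integrable M (\<lambda>\<omega>. exp (cusum (\<lambda>i. Y i \<omega>) n))"
    and "expectation (\<lambda>\<omega>. exp (cusum (\<lambda>i. Y i \<omega>) n)) \<le> real n + 1"
    using moment[of "{}" n] by (simp_all add: frozen_exp_cusum_empty)
  let ?Z = "\<lambda>\<omega>. frozen_exp_cusum {exp h..} (\<lambda>i. exp (Y i \<omega>)) n"
  have Z: "integrable M ?Z" "expectation ?Z \<le> real n + 1"
    using moment[of "{exp h..}" n] by simp_all
  have [measurable]: "?Z \<in> borel_measurable M"
    using Z by simp
  have "prob {\<omega> \<in> space M. (MAX t\<in>{0..n}. cusum (\<lambda>i. Y i \<omega>) t) \<ge> h}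
      \<le> prob {\<omega> \<in> space M. ?Z \<omega> \<ge> exp h}"
  proof (rule finite_measure_mono)
    show "{\<omega> \<in> space M. (MAX t\<in>{0..n}. cusum (\<lambda>i. Y i \<omega>) t) \<ge> h}
      \<subseteq> {\<omega> \<in> space M. ?Z \<omega> \<ge> exp h}"
      \<comment> \<open>A maximum over finitely many times reaches \<open>h\<close> only if some
        single \<open>t\<close> does.\<close>
      by (auto simp: Max_ge_iff intro: frozen_exp_cusum_ge_of_cusum_ge)
  qed measurable
  \<comment> \<open>The goal does not determine the set variable in this form of Markov's
    inequality; \<open>{}\<close> merely instantiates it and is unrelated to the freezing
    set.\<close>
  also have "\<dots> \<le> expectation ?Z / exp h"
    by (intro integral_Markov_inequality_measure[OF Z(1), of "{}"])
      (auto intro: order_trans[OF zero_le_one frozen_exp_cusum_ge_1])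
  also have "\<dots> \<le> exp (- h) * (real n + 1)"
    using Z(2) by (simp add: exp_minus field_simps)
  finally show "prob {\<omega> \<in> space M. (MAX t\<in>{0..n}. cusum (\<lambda>i. Y i \<omega>) t) \<ge> h}
      \<le> exp (- h) * (real n + 1)" .
qed

end

lemma llr_measurable:
  assumes "prob_density \<mu> f F" and "prob_density \<mu> g G"
  shows "llr f g \<in> borel_measurable F"
proof -
  have [measurable]: "f \<in> borel_measurable \<mu>" "g \<in> borel_measurable \<mu>"
    and F: "F = density \<mu> (\<lambda>x. ennreal (f x))"
    using assms by (auto simp: prob_density_def)
  have "llr f g \<in> borel_measurable \<mu>"
    unfolding llr_def[abs_def] by measurable
  then show ?thesis by (simp add: F)
qed

text \<open>The threshold is the solution \<open>h\<close> of
  \<open>exp (- h) * (real n + 1) = \<alpha>\<close>, so the tail bound taken there is exactly the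
  level.\<close>

lemma exp_neg_threshold:
  assumes "0 < \<alpha>"
  shows "exp (- threshold n \<alpha>) * (real n + 1) = \<alpha>"
proof -
  have "0 < (real n + 1) / \<alpha>" using assms by simp
  then show ?thesis
    using assms by (simp add: threshold_def exp_minus field_simps)
qed

theorem mainTheorem7:
  fixes M :: "'a measure" and \<mu> F G :: "'b measure"
    and f g :: "'b \<Rightarrow> real" and X :: "nat \<Rightarrow> 'a \<Rightarrow> 'b"
  assumes "prob_space M"
    and "prob_density \<mu> f F"
    and "prob_density \<mu> g G"
    and "iid_from M F X"
    and "llr_well_defined F f g"
    and "\<forall>i\<ge>1. (\<integral>\<omega>. exp (llr f g (X i \<omega>)) \<partial>M) = 1"
  shows "\<forall>n\<ge>1.
    integrable M (\<lambda>\<omega>. exp (llr_cusum f g X n \<omega>)) \<and>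
    (\<integral>\<omega>. exp (llr_cusum f g X n \<omega>) \<partial>M) \<le> real n + 1 \<and>
    (\<forall>h::real. measure M {\<omega> \<in> space M. (MAX t\<in>{0..n}. llr_cusum f g X t \<omega>) \<ge> h}
       \<le> exp (- h) * (real n + 1)) \<and>
    (\<forall>\<alpha>::real. 0 < \<alpha> \<and> \<alpha> < 1 \<longrightarrow>
       measure M {\<omega> \<in> space M. (MAX t\<in>{0..n}. llr_cusum f g X t \<omega>) \<ge> threshold n \<alpha>} \<le> \<alpha>)"
proof (intro allI impI conjI)
  interpret prob_space M by fact
  have X_indep: "indep_vars (\<lambda>_. F) X {1..}"
    using assms(4) by (simp add: iid_from_def)
  note [measurable] = llr_measurable[OF assms(2,3)]
  have indep: "indep_vars (\<lambda>_. borel) (\<lambda>i \<omega>. exp (llr f g (X i \<omega>))) {1..}"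
    by (rule indep_vars_compose2[OF X_indep]) measurable
  have mean: "expectation (\<lambda>\<omega>. exp (llr f g (X i \<omega>))) = 1" if "1 \<le> i" for i
    using assms(6) that by blast
  note bounds = cusum_exp_moment[of "\<lambda>i \<omega>. llr f g (X i \<omega>)", OF indep mean,
    folded llr_cusum_def]
  fix n :: nat
  show "integrable M (\<lambda>\<omega>. exp (llr_cusum f g X n \<omega>))"
    and "expectation (\<lambda>\<omega>. exp (llr_cusum f g X n \<omega>)) \<le> real n + 1"
    and "prob {\<omega> \<in> space M. (MAX t\<in>{0..n}. llr_cusum f g X t \<omega>) \<ge> h}
       \<le> exp (- h) * (real n + 1)" for h
    using bounds by simp_all
  show "prob {\<omega> \<in> space M. (MAX t\<in>{0..n}. llr_cusum f g X t \<omega>) \<ge> threshold n \<alpha>} \<le> \<alpha>"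
    if "0 < \<alpha> \<and> \<alpha> < 1" for \<alpha>
    using bounds(3)[of "threshold n \<alpha>" n] exp_neg_threshold[of \<alpha> n] that by simp
qed

end
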